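(* Let $0<\alpha<1$, $p\in[0,1]$, $T>0$, and let $h>0$ satisfy $h\le(1-\alpha)^{1/(2\alpha)}$. Let $f(\cdot,t)\in L^2(\mathbb{R})$ for each $t\in[0,T]$ and $f(x,\cdot)\in L^\infty(0,T)$ for each $x\in\mathbb{R}$. Let $u_i^n$ ($i\in\mathbb{Z}$, $n\ge0$, $nh\le T$) be the solution of the scheme $u_i^0=0$ and, for $n\ge1$, $$u_i^n=\sum_{j=0}^{n-1}(b_{n-j}-b_{n-j+1})\left(p\,u_{i+(n-j)}^j+(1-p)\,u_{i-(n-j)}^j\right)+h^{\alpha}\Gamma(2-\alpha)\left(p f_{i-1}^n+(1-p)f_{i+1}^n\right),$$ where $b_k=k^{1-\alpha}-(k-1)^{1-\alpha}$. Then $$\max_n\|u^n\|_{2,h}\le T^{\alpha}\,\Gamma(1-\alpha)\,\max_n\|f^n\|_{2,h},$$ where the maxima are over all integers $n\ge0$ with $nh\le T$.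
   Context: Grid: $x_i=ih$, $i\in\mathbb{Z}$, $t_n=nh$, $n\in\mathbb{N}$ (the same step $h$ in space and time), $x_{i\pm1/2}=(i\pm\tfrac12)h$. The grid values of the source are the cell averages $f_i^n=\frac1h\int_{x_{i-1/2}}^{x_{i+1/2}}f(x,t_n)\,dx$. Discrete norm: for a grid function $v^n=(v_i^n)_{i\in\mathbb{Z}}$, $\|v^n\|_{2,h}=\left(h\sum_{i\in\mathbb{Z}}|v_i^n|^2\right)^{1/2}$. *)

theory Defs
  imports "HOL-Analysis.Analysis"
begin

definition in_L2 :: "'a measure \<Rightarrow> ('a \<Rightarrow> real) \<Rightarrow> bool" where
  "in_L2 M g \<longleftrightarrow> g \<in> borel_measurable M \<and> integrable M (\<lambda>x. (g x)\<^sup>2)"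

definition in_Linf :: "'a measure \<Rightarrow> ('a \<Rightarrow> real) \<Rightarrow> bool" where
  "in_Linf M g \<longleftrightarrow> g \<in> borel_measurable M \<and> (\<exists>C. AE x in M. \<bar>g x\<bar> \<le> C)"

definition cell_average :: "real \<Rightarrow> (real \<Rightarrow> real \<Rightarrow> real) \<Rightarrow> nat \<Rightarrow> int \<Rightarrow> real" where
  "cell_average h f n i =
     1 / h * (LINT x:{(of_int i - 1/2) * h..(of_int i + 1/2) * h}|lebesgue. f x (real n * h))"

text \<open>The norm takes values in \<open>[0, \<infinity>]\<close>: an explicit infinite value is needed because
  \<^const>\<open>infsum\<close> is 0 on families that are not summable.\<close>

definition grid_norm :: "real \<Rightarrow> (int \<Rightarrow> real) \<Rightarrow> ennreal" where
  "grid_norm h v =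
     (if (\<lambda>i. \<bar>v i\<bar>\<^sup>2) summable_on UNIV
      then ennreal (sqrt (h * (\<Sum>\<^sub>\<infinity>i. \<bar>v i\<bar>\<^sup>2))) else \<infinity>)"

text \<open>Used for \<open>k \<ge> 1\<close> only; at \<open>k = 1\<close> the convention \<open>0 powr (1 - \<alpha>) = 0\<close> gives 1.\<close>

definition b_coeff :: "real \<Rightarrow> nat \<Rightarrow> real" where
  "b_coeff \<alpha> k = real k powr (1 - \<alpha>) - (real k - 1) powr (1 - \<alpha>)"

end

theory Submission
  imports Defs
begin

text \<open>The weights \<open>b_coeff \<alpha> m - b_coeff \<alpha> (m + 1)\<close> are nonnegative, and since \<open>u 0 = 0\<close> those that
  matter at step \<open>n\<close> sum to \<open>1 - b_coeff \<alpha> n\<close>. Shifts preserve the norm, so by Minkowski's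
  inequality and induction \<open>\<parallel>u n\<parallel> \<le> h powr \<alpha> * Gamma (2 - \<alpha>) * F / b_coeff \<alpha> n\<close>,
  where \<open>F\<close> is the largest norm of the source. The mean value theorem gives
  \<open>b_coeff \<alpha> n \<ge> (1 - \<alpha>) * n powr - \<alpha>\<close>, and \<open>n * h \<le> T\<close> finishes the proof.\<close>

text \<open>The \<open>l2\<close> norm is bounded through its finite sections, so that no infinite sums occur in the
  estimates below.\<close>

definition l2_bounded :: "('a \<Rightarrow> real) \<Rightarrow> real \<Rightarrow> bool" where
  "l2_bounded v M \<longleftrightarrow> (\<forall>A. finite A \<longrightarrow> L2_set v A \<le> M)"

lemma l2_bounded_nonneg: "l2_bounded v M \<Longrightarrow> 0 \<le> M"
  unfolding l2_bounded_def by (metis L2_set_empty finite.emptyI)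

lemma l2_bounded_mono: "l2_bounded v M \<Longrightarrow> M \<le> N \<Longrightarrow> l2_bounded v N"
  unfolding l2_bounded_def by (meson order_trans)

lemma l2_bounded_zero: "0 \<le> M \<Longrightarrow> l2_bounded (\<lambda>i. 0) M"
  by (simp add: l2_bounded_def L2_set_def)

lemma l2_bounded_add:
  assumes "l2_bounded v M" "l2_bounded w N"
  shows "l2_bounded (\<lambda>i. v i + w i) (M + N)"
  using assms unfolding l2_bounded_def by (blast intro: order_trans[OF L2_set_triangle_ineq] add_mono)

lemma l2_bounded_scale:
  assumes "l2_bounded v M" "0 \<le> c"
  shows "l2_bounded (\<lambda>i. c * v i) (c * M)"
  using assms unfolding l2_bounded_def
  by (metis L2_set_right_distrib mult_left_mono)

lemma l2_bounded_sum:
  assumes "finite J" "\<And>j. j \<in> J \<Longrightarrow> l2_bounded (v j) (M j)"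
  shows "l2_bounded (\<lambda>i. \<Sum>j\<in>J. v j i) (\<Sum>j\<in>J. M j)"
  using assms by (induction J rule: finite_induct) (auto simp: l2_bounded_zero intro!: l2_bounded_add)

text \<open>Reindexing turns a finite section over \<open>A\<close> into the one over the image of
  \<open>A\<close>; injectivity keeps any entry from being counted twice.\<close>

lemma l2_bounded_inj:
  assumes "l2_bounded v M" "inj \<sigma>"
  shows "l2_bounded (\<lambda>i. v (\<sigma> i)) M"
  unfolding l2_bounded_def
proof (intro allI impI)
  fix A :: "'b set"
  assume "finite A"
  have "L2_set (\<lambda>i. v (\<sigma> i)) A = L2_set v (\<sigma> ` A)"
    unfolding L2_set_def
    by (subst sum.reindex) (use assms(2) in \<open>auto intro: inj_on_subset\<close>)
  then show "L2_set (\<lambda>i. v (\<sigma> i)) A \<le> M"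
    using assms(1) \<open>finite A\<close> by (simp add: l2_bounded_def)
qed

text \<open>A convex combination of two shifts does not enlarge the norm. It serves both the memory
  terms and the source term of the scheme.\<close>

lemma l2_bounded_shift_average:
  fixes v :: "int \<Rightarrow> real"
  assumes "l2_bounded v M" "0 \<le> p" "p \<le> 1"
  shows "l2_bounded (\<lambda>i. p * v (i + k) + (1 - p) * v (i + l)) M"
proof -
  have "l2_bounded (\<lambda>i. v (i + m)) M" for m
    by (rule l2_bounded_inj[OF assms(1)]) (simp add: inj_def)
  then have "l2_bounded (\<lambda>i. p * v (i + k) + (1 - p) * v (i + l)) (p * M + (1 - p) * M)"
    using assms(2,3) by (intro l2_bounded_add l2_bounded_scale) auto
  then show ?thesis
    by (simp add: algebra_simps)
qed

text \<open>Bridge from the extended-valued norm to finite sections. Splitting off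
  \<open>sqrt h\<close> makes \<open>l2_bounded\<close> independent of the step.\<close>

lemma grid_norm_le_iff:
  assumes "0 < h" "0 \<le> M"
  shows "grid_norm h v \<le> ennreal (sqrt h * M) \<longleftrightarrow> l2_bounded v M"
proof
  assume le: "grid_norm h v \<le> ennreal (sqrt h * M)"
  \<comment> \<open>A finite right-hand side rules out the infinite branch of
    \<open>grid_norm\<close>.\<close>
  then have summable: "(\<lambda>i. \<bar>v i\<bar>\<^sup>2) summable_on UNIV"
    by (auto simp: grid_norm_def top_unique split: if_splits)
  with le assms have "sqrt (h * (\<Sum>\<^sub>\<infinity>i. \<bar>v i\<bar>\<^sup>2)) \<le> sqrt h * M"
    by (simp add: grid_norm_def)
  then have "sqrt (\<Sum>\<^sub>\<infinity>i. (v i)\<^sup>2) \<le> M"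
    using assms by (simp add: real_sqrt_mult)
  moreover have "(\<Sum>i\<in>A. (v i)\<^sup>2) \<le> (\<Sum>\<^sub>\<infinity>i. (v i)\<^sup>2)" if "finite A" for A
    using summable that by (intro finite_sum_le_infsum) auto
  ultimately show "l2_bounded v M"
    unfolding l2_bounded_def L2_set_def by (meson order_trans real_sqrt_le_mono)
next
  assume "l2_bounded v M"
  then have bound: "(\<Sum>i\<in>A. (v i)\<^sup>2) \<le> M\<^sup>2" if "finite A" for A
    using that by (simp add: l2_bounded_def L2_set_def sqrt_le_D)
  then have summable: "(\<lambda>i. (v i)\<^sup>2) summable_on UNIV"
    by (intro nonneg_bdd_above_summable_on bdd_aboveI2[where M = "M\<^sup>2"]) auto
  then have "(\<Sum>\<^sub>\<infinity>i. (v i)\<^sup>2) \<le> M\<^sup>2"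
    by (intro infsum_le_finite_sums) (auto simp: bound)
  then have "sqrt (\<Sum>\<^sub>\<infinity>i. (v i)\<^sup>2) \<le> M"
    using assms(2) by (rule real_le_lsqrt[rotated])
  then show "grid_norm h v \<le> ennreal (sqrt h * M)"
    using assms summable by (simp add: grid_norm_def real_sqrt_mult ennreal_leI)
qed

section \<open>Mean value estimates and monotonicity of the weights \<open>b_coeff\<close>\<close>

lemma powr_mean_value:
  fixes \<alpha> a b :: real
  assumes "\<alpha> < 1" "0 \<le> a" "a < b"
  obtains \<xi> where "a < \<xi>" "\<xi> < b"
    "b powr (1 - \<alpha>) - a powr (1 - \<alpha>) = (b - a) * ((1 - \<alpha>) * \<xi> powr - \<alpha>)"
proof -
  have "\<exists>l z. a < z \<and> z < b \<and> ((\<lambda>x. x powr (1 - \<alpha>)) has_real_derivative l) (at z)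
      \<and> b powr (1 - \<alpha>) - a powr (1 - \<alpha>) = (b - a) * l"
  proof (rule MVT)
    \<comment> \<open>The case \<open>a = 0\<close> occurs for \<open>b_coeff \<alpha> 1\<close>;
      the positive exponent gives continuity there, and differentiability is asked only in the open
      interval.\<close>
    show "continuous_on {a..b} (\<lambda>x. x powr (1 - \<alpha>))"
      using assms by (intro continuous_intros continuous_on_powr') auto
    fix x
    assume "a < x"
    then show "(\<lambda>x. x powr (1 - \<alpha>)) differentiable at x"
      using assms(2) has_real_derivative_powr[of x "1 - \<alpha>"] real_differentiable_def by fastforce
  qed (use assms in auto)
  then obtain l z where z: "a < z" "z < b"
    and l: "((\<lambda>x. x powr (1 - \<alpha>)) has_real_derivative l) (at z)"
    and eq: "b powr (1 - \<alpha>) - a powr (1 - \<alpha>) = (b - a) * l"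
    by blast
  have "l = (1 - \<alpha>) * z powr - \<alpha>"
    using DERIV_unique[OF l has_real_derivative_powr[of z "1 - \<alpha>"]] z assms(2) by simp
  with z eq that show thesis
    by blast
qed

lemma b_coeff_lower_bound:
  assumes "0 < \<alpha>" "\<alpha> < 1" "1 \<le> k"
  shows "(1 - \<alpha>) * real k powr - \<alpha> \<le> b_coeff \<alpha> k"
proof -
  obtain \<xi> where \<xi>: "real k - 1 < \<xi>" "\<xi> < real k" "b_coeff \<alpha> k = (1 - \<alpha>) * \<xi> powr - \<alpha>"
    using powr_mean_value[of \<alpha> "real k - 1" "real k"] assms by (auto simp: b_coeff_def)
  then have "real k powr - \<alpha> \<le> \<xi> powr - \<alpha>"
    using assms by (intro powr_mono2') auto
  with \<xi> assms show ?thesis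
    by simp
qed

text \<open>Here the intermediate point lies to the right of \<open>k\<close>. So the same number
  \<open>(1 - \<alpha>) * real k powr - \<alpha>\<close> separates
  \<open>b_coeff \<alpha> (Suc k)\<close> from \<open>b_coeff \<alpha> k\<close>, which yields
  monotonicity.\<close>

lemma b_coeff_Suc_upper_bound:
  assumes "0 < \<alpha>" "\<alpha> < 1" "1 \<le> k"
  shows "b_coeff \<alpha> (Suc k) \<le> (1 - \<alpha>) * real k powr - \<alpha>"
proof -
  obtain \<xi> where \<xi>: "real k < \<xi>" "b_coeff \<alpha> (Suc k) = (1 - \<alpha>) * \<xi> powr - \<alpha>"
    using powr_mean_value[of \<alpha> "real k" "real (Suc k)"] assms by (auto simp: b_coeff_def)
  then have "\<xi> powr - \<alpha> \<le> real k powr - \<alpha>"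
    using assms by (intro powr_mono2') auto
  with \<xi> assms show ?thesis
    by simp
qed

lemma b_coeff_Suc_le:
  assumes "0 < \<alpha>" "\<alpha> < 1" "1 \<le> k"
  shows "b_coeff \<alpha> (Suc k) \<le> b_coeff \<alpha> k"
  using b_coeff_lower_bound b_coeff_Suc_upper_bound assms order_trans by blast

lemma b_coeff_antimono:
  assumes "0 < \<alpha>" "\<alpha> < 1" "1 \<le> j" "j \<le> k"
  shows "b_coeff \<alpha> k \<le> b_coeff \<alpha> j"
  using assms(4)
proof (induction k rule: dec_induct)
  case (step k)
  then show ?case
    using b_coeff_Suc_le[of \<alpha> k] assms by force
qed simp

lemma b_coeff_pos:
  assumes "0 < \<alpha>" "\<alpha> < 1" "1 \<le> k"
  shows "0 < b_coeff \<alpha> k"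
  by (rule less_le_trans[OF _ b_coeff_lower_bound[OF assms]]) (use assms in simp)

text \<open>The sum telescopes and \<open>b_coeff \<alpha> 1 = 1\<close>. Starting at
  \<open>j = 1\<close> leaves \<open>b_coeff \<alpha> n\<close>; a term \<open>j = 0\<close> would
  turn it into \<open>b_coeff \<alpha> (n + 1)\<close>.\<close>

lemma sum_b_coeff_diff:
  assumes "1 \<le> n"
  shows "(\<Sum>j\<in>{1..<n}. b_coeff \<alpha> (n - j) - b_coeff \<alpha> (n - j + 1)) = 1 - b_coeff \<alpha> n"
proof -
  have "(\<Sum>j\<in>{1..<n}. b_coeff \<alpha> (n - j) - b_coeff \<alpha> (n - j + 1))
      = (\<Sum>j\<in>{1..<n}. b_coeff \<alpha> (Suc n - Suc j) - b_coeff \<alpha> (Suc n - j))"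
    by (intro sum.cong) (auto simp: Suc_diff_le)
  also have "\<dots> = b_coeff \<alpha> (Suc n - n) - b_coeff \<alpha> (Suc n - 1)"
    using assms by (rule sum_Suc_diff'[of 1 n "\<lambda>j. b_coeff \<alpha> (Suc n - j)"])
  finally show ?thesis
    by (simp add: b_coeff_def)
qed

section \<open>Induction over the time steps\<close>

lemma scheme_l2_bounded:
  fixes u f :: "nat \<Rightarrow> int \<Rightarrow> real" and \<alpha> p c G :: real
  assumes \<alpha>: "0 < \<alpha>" "\<alpha> < 1" and p: "0 \<le> p" "p \<le> 1" and c: "0 \<le> c"
    and u0: "\<And>i. u 0 i = 0"
    and scheme: "\<And>n i. 1 \<le> n \<Longrightarrow> n \<le> N \<Longrightarrow>
       u n i = (\<Sum>j<n. (b_coeff \<alpha> (n - j) - b_coeff \<alpha> (n - j + 1)) *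
                  (p * u j (i + int (n - j)) + (1 - p) * u j (i - int (n - j))))
             + c * (p * f n (i - 1) + (1 - p) * f n (i + 1))"
    and f: "\<And>n. n \<le> N \<Longrightarrow> l2_bounded (f n) G"
    and n: "1 \<le> n" "n \<le> N"
  shows "l2_bounded (u n) (c * G / b_coeff \<alpha> n)"
  using n
proof (induction n rule: less_induct)
  case (less n)
  let ?w = "\<lambda>j. b_coeff \<alpha> (n - j) - b_coeff \<alpha> (n - j + 1)"
  let ?B = "c * G / b_coeff \<alpha> n"
  have "0 \<le> G"
    using f[of 0] by (simp add: l2_bounded_nonneg)
  have pos: "0 < b_coeff \<alpha> n"
    using b_coeff_pos \<alpha> less.prems by blast
  \<comment> \<open>The bounds from the induction hypothesis grow with \<open>j\<close> because the
    weights decrease, so \<open>?B\<close> serves for all earlier steps at once.\<close>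
  have "l2_bounded (u j) ?B" if "j \<in> {1..<n}" for j
  proof -
    have "c * G / b_coeff \<alpha> j \<le> ?B"
      using b_coeff_antimono[of \<alpha> j n] that \<alpha> c \<open>0 \<le> G\<close> pos
      by (intro divide_left_mono mult_pos_pos) auto
    moreover have "l2_bounded (u j) (c * G / b_coeff \<alpha> j)"
      using less.IH[of j] less.prems that by simp
    ultimately show ?thesis
      using l2_bounded_mono by blast
  qed
  \<comment> \<open>Subtraction is written as \<open>i + - int (n - j)\<close> to match the shape
    \<open>i + l\<close> in \<open>l2_bounded_shift_average\<close>.\<close>
  then have "l2_bounded (\<lambda>i. ?w j * (p * u j (i + int (n - j)) + (1 - p) * u j (i + - int (n - j))))
      (?w j * ?B)" if "j \<in> {1..<n}" for j
    using that p b_coeff_Suc_le[of \<alpha> "n - j"] \<alpha>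
    by (intro l2_bounded_scale l2_bounded_shift_average) auto
  then have "l2_bounded (\<lambda>i. \<Sum>j\<in>{1..<n}. ?w j *
      (p * u j (i + int (n - j)) + (1 - p) * u j (i + - int (n - j)))) (\<Sum>j\<in>{1..<n}. ?w j * ?B)"
    by (intro l2_bounded_sum) auto
  moreover have "l2_bounded (\<lambda>i. c * (p * f n (i + - 1) + (1 - p) * f n (i + 1))) (c * G)"
    using f less.prems p c by (intro l2_bounded_scale l2_bounded_shift_average) auto
  ultimately have "l2_bounded (\<lambda>i. (\<Sum>j\<in>{1..<n}. ?w j *
      (p * u j (i + int (n - j)) + (1 - p) * u j (i + - int (n - j))))
      + c * (p * f n (i + - 1) + (1 - p) * f n (i + 1))) ((\<Sum>j\<in>{1..<n}. ?w j * ?B) + c * G)"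
    by (rule l2_bounded_add)
  moreover have "u n = (\<lambda>i. (\<Sum>j\<in>{1..<n}. ?w j *
      (p * u j (i + int (n - j)) + (1 - p) * u j (i + - int (n - j))))
      + c * (p * f n (i + - 1) + (1 - p) * f n (i + 1)))"
  proof
    fix i
    \<comment> \<open>The term \<open>j = 0\<close> drops out by the initial condition.\<close>
    have "{..<n} = insert 0 {1..<n}"
      using less.prems by auto
    then show "u n i = (\<Sum>j\<in>{1..<n}. ?w j *
        (p * u j (i + int (n - j)) + (1 - p) * u j (i + - int (n - j))))
        + c * (p * f n (i + - 1) + (1 - p) * f n (i + 1))"
      using scheme[OF less.prems] by (simp add: u0 del: of_nat_diff)
  qed
  \<comment> \<open>\<open>?B\<close> is the fixed point of
    \<open>B = (1 - b_coeff \<alpha> n) * B + c * G\<close>, so the induction closes without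
    loss.\<close>
  moreover have "(\<Sum>j\<in>{1..<n}. ?w j * ?B) + c * G = ?B"
  proof -
    have "(\<Sum>j\<in>{1..<n}. ?w j * ?B) = (1 - b_coeff \<alpha> n) * ?B"
      using sum_b_coeff_diff[OF less.prems(1), of \<alpha>] by (metis sum_distrib_right)
    also have "\<dots> = ?B - c * G"
      using pos by (simp add: left_diff_distrib diff_divide_distrib)
    finally show ?thesis
      by simp
  qed
  ultimately show ?case
    by simp
qed

section \<open>The stability constant and the final estimate\<close>

lemma stability_constant_bound:
  fixes \<alpha> h T :: real
  assumes \<alpha>: "0 < \<alpha>" "\<alpha> < 1" and h: "0 < h" and n: "1 \<le> n" "real n * h \<le> T"
  shows "h powr \<alpha> * Gamma (2 - \<alpha>) / b_coeff \<alpha> n \<le> T powr \<alpha> * Gamma (1 - \<alpha>)"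
proof -
  have "1 - \<alpha> \<notin> \<int>\<^sub>\<le>\<^sub>0"
    using \<alpha>(2) nonpos_Ints_nonpos by fastforce
  then have Gamma: "Gamma (2 - \<alpha>) = (1 - \<alpha>) * Gamma (1 - \<alpha>)" "0 < Gamma (1 - \<alpha>)"
    using Gamma_plus1[of "1 - \<alpha>"] \<alpha>
    by (auto intro: Gamma_real_pos)
  have "h powr \<alpha> * Gamma (2 - \<alpha>) / b_coeff \<alpha> n
      \<le> h powr \<alpha> * Gamma (2 - \<alpha>) / ((1 - \<alpha>) * real n powr - \<alpha>)"
    using \<alpha> n Gamma b_coeff_lower_bound[OF \<alpha> n(1)] b_coeff_pos[OF \<alpha> n(1)]
    by (intro divide_left_mono mult_pos_pos) auto
  \<comment> \<open>The factor \<open>1 - \<alpha>\<close> from the functional equation of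
    \<open>Gamma\<close> cancels the one from the mean value theorem.\<close>
  also have "\<dots> = (real n * h) powr \<alpha> * Gamma (1 - \<alpha>)"
    unfolding Gamma(1) using \<alpha> h n by (simp add: powr_mult powr_minus divide_simps)
  also have "\<dots> \<le> T powr \<alpha> * Gamma (1 - \<alpha>)"
    using \<alpha> h n Gamma by (intro mult_right_mono powr_mono2) auto
  finally show ?thesis .
qed

theorem proposition5:
  fixes \<alpha> p T h :: real and f :: "real \<Rightarrow> real \<Rightarrow> real" and u :: "nat \<Rightarrow> int \<Rightarrow> real"
  assumes "0 < \<alpha>" and "\<alpha> < 1"
    and "0 \<le> p" and "p \<le> 1"
    and "T > 0"
    and "h > 0" and "h \<le> (1 - \<alpha>) powr (1 / (2 * \<alpha>))"
    and "\<And>t. 0 \<le> t \<Longrightarrow> t \<le> T \<Longrightarrow> in_L2 lebesgue (\<lambda>x. f x t)"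
    and "\<And>x. in_Linf (lebesgue_on {0<..<T}) (\<lambda>t. f x t)"
    and "\<And>i. u 0 i = 0"
    and "\<And>n i. n \<ge> 1 \<Longrightarrow> real n * h \<le> T \<Longrightarrow>
       u n i = (\<Sum>j<n. (b_coeff \<alpha> (n - j) - b_coeff \<alpha> (n - j + 1)) *
                  (p * u j (i + int (n - j)) + (1 - p) * u j (i - int (n - j))))
             + h powr \<alpha> * Gamma (2 - \<alpha>) *
                  (p * cell_average h f n (i - 1) + (1 - p) * cell_average h f n (i + 1))"
  shows "(MAX n\<in>{n. real n * h \<le> T}. grid_norm h (u n))
       \<le> ennreal (T powr \<alpha> * Gamma (1 - \<alpha>)) *
         (MAX n\<in>{n. real n * h \<le> T}. grid_norm h (cell_average h f n))"
proof -
  let ?I = "{n. real n * h \<le> T}"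
  let ?c = "h powr \<alpha> * Gamma (2 - \<alpha>)"
  let ?K = "T powr \<alpha> * Gamma (1 - \<alpha>)"
  define F where "F = (MAX n\<in>?I. grid_norm h (cell_average h f n))"
  \<comment> \<open>The admissible times form a finite initial segment containing 0, so both maxima
    are genuine.\<close>
  have I_iff: "real m * h \<le> T \<longleftrightarrow> m \<le> nat \<lfloor>T / h\<rfloor>" for m
    using \<open>h > 0\<close> \<open>T > 0\<close> by (auto simp: le_nat_iff le_floor_iff pos_le_divide_eq)
  have fin: "finite ?I"
    by (simp add: I_iff)
  have ne: "?I \<noteq> {}"
    by (auto simp: I_iff)
  have "0 < Gamma (1 - \<alpha>)" "0 < Gamma (2 - \<alpha>)"
    using \<open>\<alpha> < 1\<close> by (auto intro: Gamma_real_pos)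
  then have K: "0 < ?K" and c: "0 \<le> ?c"
    using \<open>T > 0\<close> by auto
  have "grid_norm h (u n) \<le> ennreal ?K * F" if n: "n \<in> ?I" for n
  proof (cases F)
    case top
    then show ?thesis
      \<comment> \<open>Since \<open>?K\<close> is strictly positive, its product with infinity is
        infinite, not 0.\<close>
      using K by (metis ennreal_eq_0_iff ennreal_mult_top not_le top_greatest)
  next
    case (real r)
    define G where "G = r / sqrt h"
    have G: "0 \<le> G" "r = sqrt h * G"
      using real \<open>h > 0\<close> by (auto simp: G_def)
    have f_bounded: "l2_bounded (cell_average h f m) G" if "m \<in> ?I" for m
    proof -
      have "grid_norm h (cell_average h f m) \<le> F"
        unfolding F_def using fin that by (intro Max_ge) auto
      then show ?thesis
        using grid_norm_le_iff[OF \<open>h > 0\<close> G(1)] real G by simp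
    qed
    have "l2_bounded (u n) (?K * G)"
    \<comment> \<open>Step 0 lies outside \<open>scheme_l2_bounded\<close>, and the initial
      condition settles it.\<close>
    proof (cases "n = 0")
      case True
      then have "u n = (\<lambda>i. 0)"
        using assms(10) by auto
      then show ?thesis
        using K G by (simp add: l2_bounded_zero)
    next
      case False
      have "l2_bounded (u n) (?c * G / b_coeff \<alpha> n)"
        by (rule scheme_l2_bounded[where N = "nat \<lfloor>T / h\<rfloor>" and f = "cell_average h f" and u = u and p = p])
          (use assms(1-4,10,11) c f_bounded n False in \<open>simp_all add: I_iff\<close>)
      moreover have "?c / b_coeff \<alpha> n * G \<le> ?K * G"
        using stability_constant_bound[of \<alpha> h n T] assms(1,2,6) n False G(1)
        by (intro mult_right_mono) auto
      ultimately show ?thesis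
        by (auto intro: l2_bounded_mono)
    qed
    then have "grid_norm h (u n) \<le> ennreal (sqrt h * (?K * G))"
      using grid_norm_le_iff \<open>h > 0\<close> l2_bounded_nonneg by blast
    also have "sqrt h * (?K * G) = ?K * r"
      using G by simp
    also have "ennreal (?K * r) = ennreal ?K * F"
      using real K by (simp add: ennreal_mult)
    finally show ?thesis .
  qed
  then show ?thesis
    unfolding F_def using fin ne by (intro Max.boundedI) auto
qed

end
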